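(* Let $(E,\mathscr{T})$ be a second-countable $k_\omega$-space (not assumed to be Hausdorff), and let $\le$ be a closed preorder on $E$. Then there is a countable family $\{u_k\}$ of continuous utility functions $u_k: E\to [0,1]$ such that for all $x,y\in E$ \[ x \le y \ \Leftrightarrow \ \forall k, \ u_k(x)\le u_k(y). \]
   Context: A preorder is a reflexive and transitive relation. A preorder $\le$ on a topological space $E$ is closed if its graph $G(\le)=\{(x,y): x\le y\}$ is closed in the product topology on $E\times E$. A function $f:E\to\mathbb{R}$ is isotone if $x\le y \Rightarrow f(x)\le f(y)$; it is a utility if it is isotone and, in addition, "$x\le y$ and $y\nleq x$" implies $f(x)<f(y)$. A $k_\omega$-space is a topological space $E$ for which there is a countable sequence $K_i$ of compact sets such that $\bigcup_{i=1}^{\infty}K_i=E$ and, for every subset $O\subset E$, $O$ is open in $E$ if and only if $O\cap K_i$ is open in $K_i$ (with the subspace topology) for every $i$. Hausdorffness is not part of the definition of compact set or of $k_\omega$-space. *)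

theory Defs
  imports "HOL-Analysis.Analysis"
begin

(* No separation axiom: compactin does not include Hausdorffness. *)
definition k_omega_space :: "'a topology \<Rightarrow> bool" where
  "k_omega_space X \<longleftrightarrow>
     (\<exists>K :: nat \<Rightarrow> 'a set.
        (\<forall>i. compactin X (K i)) \<and>
        (\<Union>i. K i) = topspace X \<and>
        (\<forall>U. U \<subseteq> topspace X \<longrightarrow>
           (openin X U \<longleftrightarrow> (\<forall>i. openin (subtopology X (K i)) (U \<inter> K i)))))"

(* A preorder is identified with its graph, a subset of E \<times> E. *)
definition closed_preorder :: "'a topology \<Rightarrow> 'a rel \<Rightarrow> bool" where
  "closed_preorder X R \<longleftrightarrow> preorder_on (topspace X) R \<and> closedin (prod_topology X X) R"

definition isotone_on :: "'a set \<Rightarrow> 'a rel \<Rightarrow> ('a \<Rightarrow> real) \<Rightarrow> bool" where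
  "isotone_on E R f \<longleftrightarrow> (\<forall>x\<in>E. \<forall>y\<in>E. (x, y) \<in> R \<longrightarrow> f x \<le> f y)"

definition utility_on :: "'a set \<Rightarrow> 'a rel \<Rightarrow> ('a \<Rightarrow> real) \<Rightarrow> bool" where
  "utility_on E R f \<longleftrightarrow>
     isotone_on E R f \<and>
     (\<forall>x\<in>E. \<forall>y\<in>E. (x, y) \<in> R \<and> (y, x) \<notin> R \<longrightarrow> f x < f y)"

end

theory Submission
  imports Defs
begin

text \<open>
  On a compact space a closed preorder separates disjoint closed decreasing and increasing sets
  \<open>A\<close>, \<open>B\<close> by disjoint open decreasing and increasing sets: \<open>A \<times> B\<close> misses the closed reversed graph,
  so an open box around it does, and removing monotone hulls makes the box monotone. On a \<open>k\<^sub>\<omega>\<close>-space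
  with compact pieces \<open>K\<^sub>0 \<subseteq> K\<^sub>1 \<subseteq> \<dots>\<close> one enlarges \<open>A\<close> and \<open>B\<close> step by step, at stage \<open>n\<close> by the (closed)
  hulls of neighbourhoods found inside \<open>K\<^sub>n\<close>; the unions are open since each stage contains a
  \<open>K\<^sub>n\<close>-neighbourhood of the previous one. Urysohn's construction then gives continuous isotone
  functions separating any \<open>x\<close>, \<open>y\<close> with \<open>(x, y) \<notin> R\<close>, and second countability reduces them to a sequence
  \<open>f\<^sub>n\<close>. The weighted sum \<open>g\<close> of the \<open>f\<^sub>n\<close> is a utility, hence so are the combinations
  \<open>(1 - t) f\<^sub>n + t g\<close> for \<open>0 < t \<le> 1\<close>, and these recover \<open>f\<^sub>n\<close> as \<open>t\<close> tends to \<open>0\<close>.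
\<close>

section \<open>Closed preorders: duality, subspaces and hulls of compact sets\<close>

lemma closed_preorder_refl: "closed_preorder X R \<Longrightarrow> x \<in> topspace X \<Longrightarrow> (x, x) \<in> R"
  by (auto simp: closed_preorder_def preorder_on_def refl_on_def)

lemma closed_preorder_trans: "closed_preorder X R \<Longrightarrow> (x, y) \<in> R \<Longrightarrow> (y, z) \<in> R \<Longrightarrow> (x, z) \<in> R"
  by (auto simp: closed_preorder_def preorder_on_def dest: transD)

lemma closed_preorder_subset: "closed_preorder X R \<Longrightarrow> R \<subseteq> topspace X \<times> topspace X"
  by (auto simp: closed_preorder_def preorder_on_def)

lemma closed_preorder_converse:
  assumes "closed_preorder X R"
  shows "closed_preorder X (R\<inverse>)"
proof -
  have "closedin (prod_topology X X) {p \<in> topspace (prod_topology X X). prod.swap p \<in> R}"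
    using assms unfolding closed_preorder_def
    by (intro closedin_continuous_map_preimage[of _ "prod_topology X X"])
       (auto simp: prod.swap_def intro!: continuous_map_pairedI continuous_map_fst continuous_map_snd)
  moreover have "{p \<in> topspace (prod_topology X X). prod.swap p \<in> R} = R\<inverse>"
    using closed_preorder_subset[OF assms] by auto
  ultimately show ?thesis
    using assms by (simp add: closed_preorder_def)
qed

lemma closed_preorder_Restr:
  assumes "closed_preorder X R" "K \<subseteq> topspace X"
  shows "closed_preorder (subtopology X K) (Restr R K)"
proof -
  have "topspace (subtopology X K) = K"
    using assms(2) by auto
  moreover have "preorder_on K (Restr R K)"
    using assms unfolding closed_preorder_def preorder_on_def refl_on_def trans_def by blast
  moreover have "closedin (prod_topology (subtopology X K) (subtopology X K)) (Restr R K)"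
    using assms(1)
    by (auto simp: closed_preorder_def closedin_subtopology simp flip: subtopology_Times)
  ultimately show ?thesis
    by (simp add: closed_preorder_def)
qed

text \<open>Projection along a compact factor is a closed map, and the image of \<open>K\<close> is
  the projection of the part of \<open>R\<close> over \<open>K\<close>. Applied to \<open>R\<close>
  and \<open>R\<inverse>\<close>, this makes the increasing and decreasing hulls of a compact set
  closed, even where the set itself is not closed.\<close>

lemma closedin_Image_compact:
  assumes R: "closedin (prod_topology X Y) R" and K: "compactin X K"
  shows "closedin Y (R `` K)"
proof -
  have "closed_map (prod_topology (subtopology X K) Y) Y snd"
    by (simp add: K closed_map_snd compact_space_subtopology)
  moreover have "closedin (prod_topology (subtopology X K) Y) (R \<inter> K \<times> UNIV)"
    using R closedin_subset[OF R] by (auto simp: closedin_subtopology prod_topology_subtopology intro!: exI[of _ R])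
  moreover have "snd ` (R \<inter> K \<times> UNIV) = R `` K"
    by force
  ultimately show ?thesis
    by (metis closed_map_def)
qed

section \<open>Order normality and compact spaces\<close>

text \<open>Nachbin's order normality: the inclusions with \<open>R\<inverse>\<close> say that a set
  is decreasing, those with \<open>R\<close> that it is increasing. For the identity relation it is
  ordinary normality.\<close>

definition normally_preordered :: "'a topology \<Rightarrow> 'a rel \<Rightarrow> bool" where
  "normally_preordered X R \<longleftrightarrow>
     (\<forall>A B. closedin X A \<and> closedin X B \<and> A \<inter> B = {} \<and> R\<inverse> `` A \<subseteq> A \<and> R `` B \<subseteq> B \<longrightarrow>
        (\<exists>U V. openin X U \<and> openin X V \<and> A \<subseteq> U \<and> B \<subseteq> V \<and> U \<inter> V = {} \<and>
               R\<inverse> `` U \<subseteq> U \<and> R `` V \<subseteq> V))"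

lemma normally_preorderedE:
  assumes "normally_preordered X R" "closedin X A" "closedin X B" "A \<inter> B = {}"
    "R\<inverse> `` A \<subseteq> A" "R `` B \<subseteq> B"
  obtains U V where "openin X U" "openin X V" "A \<subseteq> U" "B \<subseteq> V" "U \<inter> V = {}"
    "R\<inverse> `` U \<subseteq> U" "R `` V \<subseteq> V"
  using assms unfolding normally_preordered_def by metis

lemma compact_imp_normally_preordered:
  assumes X: "compact_space X" and R: "closed_preorder X R"
  shows "normally_preordered X R"
  unfolding normally_preordered_def
proof (intro allI impI, elim conjE)
  fix A B
  assume A: "closedin X A" "R\<inverse> `` A \<subseteq> A" and B: "closedin X B" "R `` B \<subseteq> B" and AB: "A \<inter> B = {}"
  note sub = closed_preorder_subset[OF R]
  have clR: "closedin (prod_topology X X) R" and clR': "closedin (prod_topology X X) (R\<inverse>)"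
    using R closed_preorder_converse[OF R] by (auto simp: closed_preorder_def)
  \<comment> \<open>A point of \<open>B\<close> below a point of \<open>A\<close> would lie in
    \<open>A\<close>, which is decreasing.\<close>
  have "A \<times> B \<subseteq> topspace (prod_topology X X) - R\<inverse>"
    using A B AB closedin_subset by fastforce
  then obtain U V where U: "openin X U" "A \<subseteq> U" and V: "openin X V" "B \<subseteq> V"
    and UV: "U \<times> V \<subseteq> topspace (prod_topology X X) - R\<inverse>"
    using Wallace_theorem_prod_topology[of X A X B "topspace (prod_topology X X) - R\<inverse>"]
      closedin_compact_space[OF X] A B clR' by (metis openin_diff openin_topspace)
  have compl: "compactin X (topspace X - W)" if "openin X W" for W
    using that X by (simp add: closedin_compact_space closedin_diff)
  \<comment> \<open>\<open>U'\<close> is the largest decreasing subset of \<open>U\<close>, and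
    \<open>V'\<close> the largest increasing subset of \<open>V\<close>. They are open because
    complements of open sets are compact here and so have closed hulls.\<close>
  define U' where "U' = topspace X - R `` (topspace X - U)"
  define V' where "V' = topspace X - R\<inverse> `` (topspace X - V)"
  have "openin X U'" "openin X V'"
    unfolding U'_def V'_def
    using closedin_Image_compact[OF clR compl] closedin_Image_compact[OF clR' compl] U V
    by (auto intro: openin_diff)
  moreover have "A \<subseteq> U'" "B \<subseteq> V'"
    using A B U V closedin_subset[OF A(1)] closedin_subset[OF B(1)] by (auto simp: U'_def V'_def)
  moreover have "U' \<subseteq> U" "V' \<subseteq> V"
    using closed_preorder_refl[OF R] by (auto simp: U'_def V'_def)
  \<comment> \<open>A common point \<open>z\<close> would put \<open>(z, z)\<close> into the box,
    which misses the reflexive relation \<open>R\<inverse>\<close>.\<close>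
  then have "U' \<inter> V' = {}"
    using UV closed_preorder_refl[OF R] by (auto simp: U'_def)
  moreover have "R\<inverse> `` U' \<subseteq> U'" "R `` V' \<subseteq> V'"
    using sub closed_preorder_trans[OF R] unfolding U'_def V'_def by blast+
  ultimately show "\<exists>U V. openin X U \<and> openin X V \<and> A \<subseteq> U \<and> B \<subseteq> V \<and> U \<inter> V = {} \<and>
      R\<inverse> `` U \<subseteq> U \<and> R `` V \<subseteq> V"
    by blast
qed

text \<open>Normality is used twice: the complement of the first \<open>V\<close> is the closed
  decreasing \<open>P\<close>, and separating \<open>P\<close> from \<open>B\<close> yields
  \<open>Q\<close> in the same way. Closed neighbourhoods are wanted because inside a compact piece
  they are compact, so their hulls in the whole space are closed.\<close>

lemma normally_preordered_closed_nbhds: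
  assumes R: "normally_preordered X R" "R \<subseteq> topspace X \<times> topspace X"
    and A: "closedin X A" "R\<inverse> `` A \<subseteq> A" and B: "closedin X B" "R `` B \<subseteq> B" and AB: "A \<inter> B = {}"
  obtains U P V Q where "openin X U" "closedin X P" "A \<subseteq> U" "U \<subseteq> P" "R\<inverse> `` P \<subseteq> P"
    "openin X V" "closedin X Q" "B \<subseteq> V" "V \<subseteq> Q" "R `` Q \<subseteq> Q" "P \<inter> Q = {}"
proof -
  obtain U V where UV: "openin X U" "openin X V" "A \<subseteq> U" "B \<subseteq> V" "U \<inter> V = {}" "R `` V \<subseteq> V"
    using normally_preorderedE[OF R(1) A(1) B(1) AB A(2) B(2)] by metis
  define P where "P = topspace X - V"
  have clP: "closedin X P"
    using UV(2) by (auto simp: P_def)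
  have P: "P \<inter> B = {}" "R\<inverse> `` P \<subseteq> P" "U \<subseteq> P"
    using UV R(2) openin_subset[OF UV(1)] unfolding P_def by blast+
  obtain U' V' where UV': "openin X U'" "openin X V'" "P \<subseteq> U'" "B \<subseteq> V'" "U' \<inter> V' = {}" "R\<inverse> `` U' \<subseteq> U'"
    using normally_preorderedE[OF R(1) clP B(1) P(1,2) B(2)] by metis
  define Q where "Q = topspace X - U'"
  have clQ: "closedin X Q"
    using UV'(1) by (auto simp: Q_def)
  have Q: "R `` Q \<subseteq> Q" "V' \<subseteq> Q" "P \<inter> Q = {}"
    using UV' R(2) openin_subset[OF UV'(2)] unfolding Q_def by blast+
  show thesis
    by (rule that[OF UV(1) clP UV(3) P(3,2) UV'(2) clQ UV'(4) Q(2,1,3)])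
qed

text \<open>A subset of \<open>K\<close> that is monotone within \<open>K\<close> gains no points of \<open>K\<close> when it is saturated in the
  whole space, so separating sets found inside \<open>K\<close> can be saturated and stay disjoint.\<close>
lemma closed_preorder_enlarge:
  assumes R: "closed_preorder X R" and K: "compactin X K"
    and A: "closedin X A" "R\<inverse> `` A \<subseteq> A" and B: "closedin X B" "R `` B \<subseteq> B" and AB: "A \<inter> B = {}"
  obtains A' B' U V where "closedin X A'" "R\<inverse> `` A' \<subseteq> A'" "closedin X B'" "R `` B' \<subseteq> B'" "A' \<inter> B' = {}"
    "A \<subseteq> A'" "B \<subseteq> B'"
    "openin (subtopology X K) U" "A \<inter> K \<subseteq> U" "U \<subseteq> A'"
    "openin (subtopology X K) V" "B \<inter> K \<subseteq> V" "V \<subseteq> B'"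
proof -
  let ?Y = "subtopology X K" and ?S = "Restr R K"
  have KX: "K \<subseteq> topspace X"
    using K compactin_subset_topspace by blast
  have S: "closed_preorder ?Y ?S" "compact_space ?Y"
    using closed_preorder_Restr[OF R KX] K compact_space_subtopology by blast+
  have clAB: "closedin ?Y (A \<inter> K)" "closedin ?Y (B \<inter> K)"
    using A(1) B(1) by (auto simp: closedin_subtopology)
  have monoAB: "?S\<inverse> `` (A \<inter> K) \<subseteq> A \<inter> K" "?S `` (B \<inter> K) \<subseteq> B \<inter> K" "(A \<inter> K) \<inter> (B \<inter> K) = {}"
    using A(2) B(2) AB by blast+
  obtain U P V Q where U: "openin ?Y U" "A \<inter> K \<subseteq> U" "U \<subseteq> P" and V: "openin ?Y V" "B \<inter> K \<subseteq> V" "V \<subseteq> Q"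
    and P: "closedin ?Y P" "?S\<inverse> `` P \<subseteq> P" and Q: "closedin ?Y Q" "?S `` Q \<subseteq> Q" and PQ: "P \<inter> Q = {}"
    using normally_preordered_closed_nbhds[OF compact_imp_normally_preordered[OF S(2,1)]
        closed_preorder_subset[OF S(1)] clAB(1) monoAB(1) clAB(2) monoAB(2,3)] by metis
  have PK: "P \<subseteq> K" "Q \<subseteq> K"
    using P(1) Q(1) closedin_imp_subset by blast+
  have "compactin X P" "compactin X Q"
    using closedin_compact_space[OF S(2)] P(1) Q(1) by (auto simp: compactin_subtopology)
  then have hull: "closedin X (R\<inverse> `` P)" "closedin X (R `` Q)"
    using R closed_preorder_converse[OF R] closedin_Image_compact unfolding closed_preorder_def by blast+
  have incl: "P \<subseteq> R\<inverse> `` P" "Q \<subseteq> R `` Q"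
    using closed_preorder_refl[OF R] PK KX by blast+
  show thesis
  proof (rule that[of "A \<union> R\<inverse> `` P" "B \<union> R `` Q" U V])
    show "closedin X (A \<union> R\<inverse> `` P)" "closedin X (B \<union> R `` Q)"
      using A B hull by auto
    show "R\<inverse> `` (A \<union> R\<inverse> `` P) \<subseteq> A \<union> R\<inverse> `` P" "R `` (B \<union> R `` Q) \<subseteq> B \<union> R `` Q"
      using A(2) B(2) closed_preorder_trans[OF R] by blast+
    \<comment> \<open>A point of \<open>A\<close> above some \<open>q\<close> in \<open>Q\<close>
      forces \<open>q\<close> into \<open>A \<inter> K\<close>, hence into \<open>P\<close>.\<close>
    have "A \<inter> R `` Q = {}"
      using A(2) U PQ PK by blast
    moreover have "R\<inverse> `` P \<inter> B = {}"
      using B(2) V PQ PK by blast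
    \<comment> \<open>A common point of the two hulls gives, by transitivity, some \<open>q\<close>
      in \<open>Q\<close> below some \<open>p\<close> in \<open>P\<close>. Both lie in
      \<open>K\<close>, so \<open>q\<close> is in \<open>P\<close>.\<close>
    moreover have "R\<inverse> `` P \<inter> R `` Q = {}"
      using closed_preorder_trans[OF R] PQ PK P(2) Q(2) by blast
    ultimately show "(A \<union> R\<inverse> `` P) \<inter> (B \<union> R `` Q) = {}"
      using AB by blast
  qed (use U V incl in blast)+
qed

section \<open>Order normality of k-omega spaces\<close>

text \<open>Finite partial unions of the given compact sets work: they contain the original sets, so
  a set with open traces on them has open traces on those.\<close>

lemma k_omega_space_increasing:
  assumes "k_omega_space X"
  obtains K :: "nat \<Rightarrow> 'a set" where "\<And>i. compactin X (K i)" "incseq K"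
    "\<And>U. U \<subseteq> topspace X \<Longrightarrow> (\<And>i. openin (subtopology X (K i)) (U \<inter> K i)) \<Longrightarrow> openin X U"
proof -
  obtain K :: "nat \<Rightarrow> 'a set" where K: "\<And>i. compactin X (K i)"
    "\<And>U. U \<subseteq> topspace X \<Longrightarrow> (\<And>i. openin (subtopology X (K i)) (U \<inter> K i)) \<Longrightarrow> openin X U"
    using assms unfolding k_omega_space_def by metis
  show thesis
  proof
    show "compactin X (\<Union>j\<le>i. K j)" for i
      using K(1) by (intro compactin_Union) auto
    show "incseq (\<lambda>i. \<Union>j\<le>i. K j)"
      by (intro monoI UN_mono) auto
    show "openin X U"
      if U: "U \<subseteq> topspace X" "\<And>i. openin (subtopology X (\<Union>j\<le>i. K j)) (U \<inter> (\<Union>j\<le>i. K j))" for U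
    proof (rule K(2)[OF U(1)])
      fix i
      obtain W where "openin X W" "U \<inter> (\<Union>j\<le>i. K j) = W \<inter> (\<Union>j\<le>i. K j)"
        using U(2)[of i] by (auto simp: openin_subtopology)
      then have "openin X W" "U \<inter> K i = W \<inter> K i"
        by blast+
      then show "openin (subtopology X (K i)) (U \<inter> K i)"
        by (auto simp: openin_subtopology)
    qed
  qed
qed

text \<open>A point of \<open>A n\<close> in \<open>K i\<close> also lies in
  \<open>A m \<inter> K m\<close> for \<open>m = max n i\<close>, hence in the open set of stage
  \<open>m\<close>. So the trace of the union on \<open>K i\<close> is a union of traces of open
  sets from stages \<open>n \<ge> i\<close>, each open in \<open>K i\<close> because
  \<open>K i \<subseteq> K n\<close>.\<close>

lemma openin_Union_interleaved:
  assumes K: "incseq K" and open_if: "\<And>U. U \<subseteq> topspace X \<Longrightarrow>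
      (\<And>i. openin (subtopology X (K i)) (U \<inter> K i)) \<Longrightarrow> openin X U"
    and A: "\<And>n. A n \<subseteq> topspace X" "\<And>n. A n \<subseteq> A (Suc n)"
    and W: "\<And>n. \<exists>U. openin (subtopology X (K n)) U \<and> A n \<inter> K n \<subseteq> U \<and> U \<subseteq> A (Suc n)"
  shows "openin X (\<Union>n. A n)"
proof (rule open_if)
  show "(\<Union>n. A n) \<subseteq> topspace X"
    using A by blast
  fix i
  obtain U where U: "\<And>n. openin (subtopology X (K n)) (U n)" "\<And>n. A n \<inter> K n \<subseteq> U n" "\<And>n. U n \<subseteq> A (Suc n)"
    using W by metis
  have incA: "incseq A"
    using A(2) by (rule incseq_SucI)
  have "x \<in> (\<Union>n\<in>{i..}. U n \<inter> K i)" if "x \<in> A n" "x \<in> K i" for x n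
  proof -
    have "x \<in> A (max n i)" "x \<in> K (max n i)"
      using that incseqD[OF incA, of n "max n i"] incseqD[OF K, of i "max n i"] by auto
    then have "x \<in> U (max n i)"
      using U(2) by blast
    then show ?thesis
      using that by (intro UN_I[of "max n i"]) auto
  qed
  then have eq: "(\<Union>n. A n) \<inter> K i = (\<Union>n\<in>{i..}. U n \<inter> K i)"
    using U(3) by blast
  have "openin (subtopology X (K i)) (U n \<inter> K i)" if "n \<ge> i" for n
  proof -
    obtain W where "openin X W" "U n = W \<inter> K n"
      using U(1)[of n] by (auto simp: openin_subtopology)
    moreover have "K i \<subseteq> K n"
      using K that by (rule incseqD)
    ultimately have "openin X W" "U n \<inter> K i = W \<inter> K i"
      by auto
    then show ?thesis
      by (auto simp: openin_subtopology)
  qed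
  then show "openin (subtopology X (K i)) ((\<Union>n. A n) \<inter> K i)"
    unfolding eq by (intro openin_Union) blast
qed

theorem k_omega_imp_normally_preordered:
  assumes X: "k_omega_space X" and R: "closed_preorder X R"
  shows "normally_preordered X R"
  unfolding normally_preordered_def
proof (intro allI impI, elim conjE)
  fix A B
  assume A: "closedin X A" "R\<inverse> `` A \<subseteq> A" and B: "closedin X B" "R `` B \<subseteq> B" and AB: "A \<inter> B = {}"
  obtain K :: "nat \<Rightarrow> 'a set" where K: "\<And>i. compactin X (K i)" "incseq K"
    and open_if: "\<And>U. U \<subseteq> topspace X \<Longrightarrow> (\<And>i. openin (subtopology X (K i)) (U \<inter> K i)) \<Longrightarrow> openin X U"
    using k_omega_space_increasing[OF X] by metis
  define sep where "sep C D \<longleftrightarrow> closedin X C \<and> R\<inverse> `` C \<subseteq> C \<and> closedin X D \<and> R `` D \<subseteq> D \<and> C \<inter> D = {}" for C D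
  define next_step where "next_step n C C' \<longleftrightarrow> C \<subseteq> C' \<and>
      (\<exists>U. openin (subtopology X (K n)) U \<and> C \<inter> K n \<subseteq> U \<and> U \<subseteq> C')" for n C C'
  \<comment> \<open>Dependent choice on pairs, with \<open>sep\<close> as invariant. The clause for
    \<open>n = 0\<close> fixes the initial pair and is vacuous at later stages.\<close>
  have "\<exists>F. \<forall>n. (sep (fst (F n)) (snd (F n)) \<and> (n = 0 \<longrightarrow> F n = (A, B))) \<and>
      (next_step n (fst (F n)) (fst (F (Suc n))) \<and> next_step n (snd (F n)) (snd (F (Suc n))))"
  proof (rule dependent_nat_choice)
    show "\<exists>p. sep (fst p) (snd p) \<and> ((0::nat) = 0 \<longrightarrow> p = (A, B))"
      using A B AB by (auto simp: sep_def)
    fix p :: "'a set \<times> 'a set" and n :: nat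
    assume "sep (fst p) (snd p) \<and> (n = 0 \<longrightarrow> p = (A, B))"
    then have "closedin X (fst p)" "R\<inverse> `` fst p \<subseteq> fst p" "closedin X (snd p)" "R `` snd p \<subseteq> snd p"
      "fst p \<inter> snd p = {}"
      by (auto simp: sep_def)
    from closed_preorder_enlarge[OF R K(1)[of n] this]
    obtain A' B' where "sep A' B'" "next_step n (fst p) A'" "next_step n (snd p) B'"
      unfolding sep_def next_step_def by metis
    then show "\<exists>q. (sep (fst q) (snd q) \<and> (Suc n = 0 \<longrightarrow> q = (A, B))) \<and>
        (next_step n (fst p) (fst q) \<and> next_step n (snd p) (snd q))"
      by (intro exI[of _ "(A', B')"]) auto
  qed
  then obtain F where F: "\<And>n. sep (fst (F n)) (snd (F n))" "F 0 = (A, B)"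
    "\<And>n. next_step n (fst (F n)) (fst (F (Suc n)))" "\<And>n. next_step n (snd (F n)) (snd (F (Suc n)))"
    by metis
  let ?U = "\<Union>n. fst (F n)" and ?V = "\<Union>n. snd (F n)"
  have sub: "fst (F n) \<subseteq> topspace X" "snd (F n) \<subseteq> topspace X" for n
    using F(1)[of n] by (auto simp: sep_def dest: closedin_subset)
  have "openin X ?U"
    using F(3) unfolding next_step_def
    by (intro openin_Union_interleaved[OF K(2) open_if sub(1)]) auto
  moreover have "openin X ?V"
    using F(4) unfolding next_step_def
    by (intro openin_Union_interleaved[OF K(2) open_if sub(2)]) auto
  moreover have "A \<subseteq> ?U" "B \<subseteq> ?V"
    using F(2) by (metis UN_upper UNIV_I fst_conv, metis UN_upper UNIV_I snd_conv)
  moreover have "?U \<inter> ?V = {}"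
  proof -
    have inc: "incseq (\<lambda>n. fst (F n))" "incseq (\<lambda>n. snd (F n))"
      using F(3,4) unfolding next_step_def by (blast intro: incseq_SucI)+
    \<comment> \<open>Both sets are contained in those of stage \<open>max m n\<close>, which are
      disjoint.\<close>
    have "fst (F m) \<inter> snd (F n) = {}" for m n
      using incseqD[OF inc(1) max.cobounded1[of m n]] incseqD[OF inc(2) max.cobounded2[of n m]]
        F(1)[of "max m n"]
      unfolding sep_def by blast
    then show ?thesis
      by blast
  qed
  moreover have "R\<inverse> `` ?U \<subseteq> ?U" "R `` ?V \<subseteq> ?V"
    using F(1) unfolding sep_def Image_UN by (simp_all add: UN_mono)
  ultimately show "\<exists>U V. openin X U \<and> openin X V \<and> A \<subseteq> U \<and> B \<subseteq> V \<and> U \<inter> V = {} \<and>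
      R\<inverse> `` U \<subseteq> U \<and> R `` V \<subseteq> V"
    by blast
qed

section \<open>Urysohn functions for normal preorders\<close>

lemma dyadic_between:
  assumes "0 \<le> a" "a < (b::real)"
  obtains r where "r \<in> dyadics" "a < r" "r < b"
proof -
  \<comment> \<open>Two dyadics straddle the midpoint at distance less than half the length of the
    interval; the upper one lies in it.\<close>
  have "0 < (b - a) / 2" "(1::real) < 2" "0 < (a + b) / 2"
    using assms by auto
  then obtain n q r where "real q / 2 ^ n < (a + b) / 2" "(a + b) / 2 < real r / 2 ^ n"
      "\<bar>real q / 2 ^ n - real r / 2 ^ n\<bar> < (b - a) / 2"
    using padic_rational_approximation_straddle_pos by metis
  then have "a < real r / 2 ^ n" "real r / 2 ^ n < b"
    using assms by (auto simp: field_simps abs_less_iff)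
  moreover have "real r / 2 ^ n \<in> dyadics"
    by (auto simp: dyadics_def)
  ultimately show thesis
    using that by blast
qed

text \<open>Urysohn's dyadic construction with open decreasing sets in place of open sets.\<close>
theorem normally_preordered_Urysohn:
  assumes N: "normally_preordered X R" "R \<subseteq> topspace X \<times> topspace X"
    and A: "closedin X A" "R\<inverse> `` A \<subseteq> A" and B: "closedin X B" "R `` B \<subseteq> B" and AB: "A \<inter> B = {}"
  obtains f :: "'a \<Rightarrow> real" where "continuous_map X (top_of_set {0..1}) f" "isotone_on (topspace X) R f"
    "\<And>x. x \<in> A \<Longrightarrow> f x = 0" "\<And>x. x \<in> B \<Longrightarrow> f x = 1"
proof -
  \<comment> \<open>The closed decreasing \<open>C\<close> takes the place of the closure of
    \<open>U\<close>, which may fail to be decreasing.\<close>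
  define inside where "inside U V \<longleftrightarrow> openin X U \<and> openin X V \<and> R\<inverse> `` U \<subseteq> U \<and> R\<inverse> `` V \<subseteq> V \<and>
      (\<exists>C. closedin X C \<and> R\<inverse> `` C \<subseteq> C \<and> U \<subseteq> C \<and> C \<subseteq> V)" for U V
  have compl: "closedin X (topspace X - V)" "R `` (topspace X - V) \<subseteq> topspace X - V"
    if "openin X V" "R\<inverse> `` V \<subseteq> V" for V
    using that N(2) by auto
  have interpolate: "\<exists>U. inside U V \<and> C \<subseteq> U"
    if C: "closedin X C" "R\<inverse> `` C \<subseteq> C" and V: "openin X V" "R\<inverse> `` V \<subseteq> V" and "C \<subseteq> V" for C V
  proof -
    \<comment> \<open>Separate \<open>C\<close> from the complement of \<open>V\<close>; the
      complement of the increasing side \<open>W\<close> is then the closed decreasing set between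
      \<open>U\<close> and \<open>V\<close>.\<close>
    have "C \<inter> (topspace X - V) = {}"
      using that by blast
    then obtain U W where UW: "openin X U" "openin X W" "C \<subseteq> U" "topspace X - V \<subseteq> W" "U \<inter> W = {}"
      "R\<inverse> `` U \<subseteq> U" "R `` W \<subseteq> W"
      using normally_preorderedE[OF N(1) C(1) compl(1)[OF V] _ C(2) compl(2)[OF V]] by metis
    have "closedin X (topspace X - W)"
      using UW(2) by auto
    moreover have "R\<inverse> `` (topspace X - W) \<subseteq> topspace X - W" "U \<subseteq> topspace X - W" "topspace X - W \<subseteq> V"
      using UW N(2) openin_subset[OF UW(1)] by blast+
    ultimately show ?thesis
      unfolding inside_def using UW V by blast
  qed
  have opB: "openin X (topspace X - B)" "R\<inverse> `` (topspace X - B) \<subseteq> topspace X - B" "A \<subseteq> topspace X - B"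
    using B A AB N(2) closedin_subset[OF A(1)] by blast+
  obtain U where U: "inside U (topspace X - B)" "A \<subseteq> U"
    using interpolate[OF A opB] by blast
  obtain G :: "real \<Rightarrow> 'a set" where G0: "G 0 = U" and G1: "G 1 = topspace X - B"
    and G: "\<forall>x \<in> dyadics \<inter> {0..1}. \<forall>y \<in> dyadics \<inter> {0..1}. x < y \<longrightarrow> inside (G x) (G y)"
  proof (rule exE[OF recursion_on_dyadic_fractions[of inside, OF U(1)]])
    show "\<exists>W. inside V W \<and> inside W V'" if "inside V V'" for V V'
    proof -
      obtain C where "closedin X C" "R\<inverse> `` C \<subseteq> C" "V \<subseteq> C" "C \<subseteq> V'"
        and VV': "openin X V" "R\<inverse> `` V \<subseteq> V" "openin X V'" "R\<inverse> `` V' \<subseteq> V'"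
        using \<open>inside V V'\<close> unfolding inside_def by blast
      then obtain W where W: "inside W V'" "C \<subseteq> W"
        using interpolate by meson
      then have "inside V W"
        using \<open>closedin X C\<close> \<open>R\<inverse> `` C \<subseteq> C\<close> \<open>V \<subseteq> C\<close> VV' unfolding inside_def by blast
      with W show ?thesis
        by blast
    qed
    show "inside V V''" if "inside V V'" "inside V' V''" for V V' V''
      using that unfolding inside_def by (meson subset_trans)
  qed blast
  have 01: "0 \<in> dyadics \<inter> {0..1::real}" "1 \<in> dyadics \<inter> {0..1::real}"
    using real_in_dyadics[of 0] real_in_dyadics[of 1] by auto
  have Gr: "openin X (G r)" "R\<inverse> `` G r \<subseteq> G r" if "r \<in> dyadics \<inter> {0..1}" for r
  proof -
    have "openin X (G r) \<and> R\<inverse> `` G r \<subseteq> G r"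
    \<comment> \<open>For \<open>r < 1\<close> the properties come from comparison with the larger
      index 1, which is itself treated directly.\<close>
    proof (cases "r = 1")
      case True
      then show ?thesis using G1 opB by simp
    next
      case False
      then have "inside (G r) (G 1)"
        using G that 01 by auto
      then show ?thesis
        by (simp add: inside_def)
    qed
    then show "openin X (G r)" "R\<inverse> `` G r \<subseteq> G r"
      by auto
  qed
  have Gmono: "G r \<subseteq> G s" if "r \<in> dyadics \<inter> {0..1}" "s \<in> dyadics \<inter> {0..1}" "r \<le> s" for r s
  proof (cases "r = s")
    case False
    then have "inside (G r) (G s)"
      using G that by auto
    then show ?thesis
      by (auto simp: inside_def)
  qed auto
  \<comment> \<open>Inserting 1 gives the value 1 at points in no \<open>G r\<close>, among them
    those of \<open>B\<close>.\<close>
  define f where "f x = Inf (insert 1 {r \<in> dyadics \<inter> {0..1}. x \<in> G r})" for x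
  have bdd: "bdd_below (insert 1 {r \<in> dyadics \<inter> {0..1::real}. x \<in> G r})" for x
    by (auto intro!: bdd_belowI[of _ 0])
  have f_ge: "c \<le> f x" if "c \<le> 1" "\<And>r. \<lbrakk>r \<in> dyadics \<inter> {0..1}; x \<in> G r\<rbrakk> \<Longrightarrow> c \<le> r" for c x
    unfolding f_def using that by (intro cInf_greatest) auto
  have f_le: "f x \<le> r" if "r \<in> dyadics \<inter> {0..1}" "x \<in> G r" for x r
    unfolding f_def using that bdd by (intro cInf_lower) auto
  have f_le_1: "f x \<le> 1" for x
    unfolding f_def using bdd by (intro cInf_lower) auto
  have f_less: "\<exists>r \<in> dyadics \<inter> {0..1}. r < c \<and> x \<in> G r" if "f x < c" "c \<le> 1" for x c
    using f_ge[of c x] that by (meson not_le)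
  have f_nonneg: "0 \<le> f x" for x
    by (rule f_ge) auto
  have G_if_less: "x \<in> G r" if "r \<in> dyadics \<inter> {0..1}" "f x < r" for x r
    using f_less[of x r] that Gmono by fastforce
  show thesis
  proof (rule that[of f])
    have "openin X {x \<in> topspace X. f x < c}" for c
    proof (cases "c \<le> 1")
      case True
      have "{x \<in> topspace X. f x < c} = (\<Union>r \<in> {r \<in> dyadics \<inter> {0..1}. r < c}. G r)"
        using f_less[OF _ True] f_le Gr(1) openin_subset by fastforce
      then show ?thesis
        using Gr(1) by auto
    next
      case False
      then have "{x \<in> topspace X. f x < c} = topspace X"
        using f_le_1 by (smt (verit) Collect_cong Collect_mem_eq)
      then show ?thesis
        by simp
    qed
    moreover have "openin X {x \<in> topspace X. f x > c}" for c
    proof (subst openin_subopen, intro ballI, elim CollectE conjE)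
      fix x assume x: "x \<in> topspace X" "c < f x"
      show "\<exists>T. openin X T \<and> x \<in> T \<and> T \<subseteq> {x \<in> topspace X. f x > c}"
      \<comment> \<open>Dyadics are nonnegative here, so negative thresholds are treated
        apart.\<close>
      proof (cases "c < 0")
        case True
        then have "topspace X \<subseteq> {x \<in> topspace X. f x > c}"
          using f_nonneg by (auto intro: less_le_trans)
        then show ?thesis
          using x by blast
      next
        case False
        \<comment> \<open>With \<open>c < r < s < f x\<close>, take a closed \<open>C\<close>
          between \<open>G r\<close> and \<open>G s\<close>. Then \<open>x\<close> is outside
          \<open>G s\<close>, hence outside \<open>C\<close>, while outside \<open>C\<close> a point
          avoids \<open>G r\<close> and so has value at least \<open>r\<close>.\<close>
        then obtain s where s: "s \<in> dyadics" "c < s" "s < f x"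
          using dyadic_between[of c "f x"] x by auto
        then obtain r where r: "r \<in> dyadics" "c < r" "r < s"
          using dyadic_between[of c s] False by auto
        have rs: "r \<in> dyadics \<inter> {0..1}" "s \<in> dyadics \<inter> {0..1}"
          using r s False f_le_1[of x] by auto
        then obtain C where C: "closedin X C" "G r \<subseteq> C" "C \<subseteq> G s"
          using G r unfolding inside_def by meson
        have "x \<notin> C"
          using f_le[OF rs(2)] s C by force
        moreover have "c < f y" if "y \<notin> C" for y
          using G_if_less[OF rs(1), of y] C that r by force
        ultimately show ?thesis
          using C(1) x by (intro exI[of _ "topspace X - C"]) auto
      qed
    qed
    ultimately show "continuous_map X (top_of_set {0..1}) f"
      by (simp add: continuous_map_upper_lower_semicontinuous_lt_gen f_nonneg f_le_1)
    show "isotone_on (topspace X) R f"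
      unfolding isotone_on_def
    proof (intro ballI impI)
      fix x y assume "(x, y) \<in> R"
      \<comment> \<open>Since each \<open>G r\<close> is decreasing, the infimum for
        \<open>x\<close> ranges over a larger set than that for \<open>y\<close>.\<close>
      then have "x \<in> G r" if "r \<in> dyadics \<inter> {0..1}" "y \<in> G r" for r
        using Gr(2) that by blast
      then show "f x \<le> f y"
        using f_le f_le_1 by (intro f_ge) auto
    qed
    show "f x = 0" if "x \<in> A" for x
      using f_le[OF 01(1), of x] G0 U(2) that f_nonneg[of x] by auto
    show "f x = 1" if "x \<in> B" for x
    proof (rule antisym[OF f_le_1 f_ge])
      show "1 \<le> r" if "r \<in> dyadics \<inter> {0..1}" "x \<in> G r" for r
        using Gmono[OF that(1) 01(2)] that G1 \<open>x \<in> B\<close> by auto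
    qed simp
  qed
qed

section \<open>Countably many separating isotone functions\<close>

text \<open>The decreasing hull of \<open>y\<close> and the increasing hull of \<open>x\<close> are
  closed, as hulls of compact singletons. A common point would give \<open>(x, y) \<in> R\<close> by
  transitivity, so Urysohn's construction applies to them.\<close>

lemma closed_preorder_separating_isotone:
  assumes N: "normally_preordered X R" and R: "closed_preorder X R"
    and xy: "x \<in> topspace X" "y \<in> topspace X" "(x, y) \<notin> R"
  obtains f :: "'a \<Rightarrow> real" where "continuous_map X (top_of_set {0..1}) f" "isotone_on (topspace X) R f"
    "f y < f x"
proof -
  have "closedin X (R\<inverse> `` {y})" "closedin X (R `` {x})"
    using R closed_preorder_converse[OF R] xy closedin_Image_compact[of X X]
    unfolding closed_preorder_def by (meson compactin_sing)+
  moreover have "R\<inverse> `` (R\<inverse> `` {y}) \<subseteq> R\<inverse> `` {y}" "R `` (R `` {x}) \<subseteq> R `` {x}"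
    "R\<inverse> `` {y} \<inter> R `` {x} = {}"
    using closed_preorder_trans[OF R] xy(3) by blast+
  moreover have "y \<in> R\<inverse> `` {y}" "x \<in> R `` {x}"
    using closed_preorder_refl[OF R] xy by auto
  ultimately obtain f :: "'a \<Rightarrow> real" where "continuous_map X (top_of_set {0..1}) f"
    "isotone_on (topspace X) R f" "f y = 0" "f x = 1"
    using normally_preordered_Urysohn[OF N closed_preorder_subset[OF R]] by metis
  then show thesis
    using that by simp
qed

text \<open>If \<open>g y < g x\<close>, a value \<open>c\<close> strictly in between yields basic
  sets around \<open>x\<close> and \<open>y\<close> on which \<open>g\<close> stays above and below
  \<open>c\<close>. It therefore suffices to choose one function for each pair of basic sets that
  can be separated in this way.\<close>

lemma countable_separating_isotones:
  assumes X: "second_countable X"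
    and sep: "\<And>x y. \<lbrakk>x \<in> topspace X; y \<in> topspace X; (x, y) \<notin> R\<rbrakk> \<Longrightarrow>
      \<exists>f::'a \<Rightarrow> real. continuous_map X (top_of_set {0..1}) f \<and> isotone_on (topspace X) R f \<and> f y < f x"
  obtains f :: "nat \<Rightarrow> 'a \<Rightarrow> real" where "\<And>n. continuous_map X (top_of_set {0..1}) (f n)"
    "\<And>n. isotone_on (topspace X) R (f n)"
    "\<And>x y. \<lbrakk>x \<in> topspace X; y \<in> topspace X; (x, y) \<notin> R\<rbrakk> \<Longrightarrow> \<exists>n. f n y < f n x"
proof -
  define iso where "iso f \<longleftrightarrow> continuous_map X (top_of_set {0..1}) f \<and> isotone_on (topspace X) R f"
    for f :: "'a \<Rightarrow> real"
  obtain \<B> where \<B>: "countable \<B>" "\<And>U x. \<lbrakk>openin X U; x \<in> U\<rbrakk> \<Longrightarrow> \<exists>V\<in>\<B>. x \<in> V \<and> V \<subseteq> U"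
    using X unfolding second_countable_def by metis
  \<comment> \<open>Pairs that admit no such function still receive some isotone function, the
    constant 0 showing that one exists.\<close>
  have "\<forall>p. \<exists>f. iso f \<and> ((\<exists>g. iso g \<and> (\<forall>x\<in>fst p. \<forall>y\<in>snd p. g y < g x)) \<longrightarrow> (\<forall>x\<in>fst p. \<forall>y\<in>snd p. f y < f x))"
  proof
    fix p
    have "iso (\<lambda>_. 0)"
      by (simp add: iso_def isotone_on_def)
    then show "\<exists>f. iso f \<and> ((\<exists>g. iso g \<and> (\<forall>x\<in>fst p. \<forall>y\<in>snd p. g y < g x)) \<longrightarrow> (\<forall>x\<in>fst p. \<forall>y\<in>snd p. f y < f x))"
      by blast
  qed
  then obtain \<phi> where \<phi>: "\<And>p. iso (\<phi> p)"
    "\<And>p g. \<lbrakk>iso g; \<And>x y. x \<in> fst p \<Longrightarrow> y \<in> snd p \<Longrightarrow> g y < g x\<rbrakk> \<Longrightarrow> \<forall>x\<in>fst p. \<forall>y\<in>snd p. \<phi> p y < \<phi> p x"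
    by metis
  let ?P = "insert ({}, {}) (\<B> \<times> \<B>)"
  have cnt: "countable ?P"
    using \<B>(1) by auto
  show thesis
  proof (rule that[of "\<lambda>n. \<phi> (from_nat_into ?P n)"])
    show "continuous_map X (top_of_set {0..1}) (\<phi> (from_nat_into ?P n))"
      "isotone_on (topspace X) R (\<phi> (from_nat_into ?P n))" for n
      using \<phi>(1) by (auto simp: iso_def)
    fix x y assume xy: "x \<in> topspace X" "y \<in> topspace X" "(x, y) \<notin> R"
    obtain g where g: "iso g" "g y < g x"
      using sep[OF xy] iso_def by auto
    define c where "c = (g x + g y) / 2"
    have c: "g y < c" "c < g x"
      using g(2) by (auto simp: c_def)
    have "continuous_map X euclideanreal g"
      using g(1) by (simp add: iso_def continuous_map_in_subtopology)
    then have "openin X {z \<in> topspace X. c < g z}" "openin X {z \<in> topspace X. g z < c}"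
      by (simp_all add: continuous_map_upper_lower_semicontinuous_lt)
    then obtain U V where "U \<in> \<B>" "x \<in> U" "U \<subseteq> {z \<in> topspace X. c < g z}"
      and "V \<in> \<B>" "y \<in> V" "V \<subseteq> {z \<in> topspace X. g z < c}"
      using \<B>(2)[of _ x] \<B>(2)[of _ y] xy c by (metis (mono_tags, lifting) mem_Collect_eq)
    then have "\<phi> (U, V) y < \<phi> (U, V) x"
      using \<phi>(2)[OF g(1), of "(U, V)"] by fastforce
    moreover obtain n where "from_nat_into ?P n = (U, V)"
      using from_nat_into_surj[OF cnt, of "(U, V)"] \<open>U \<in> \<B>\<close> \<open>V \<in> \<B>\<close> by auto
    ultimately show "\<exists>n. \<phi> (from_nat_into ?P n) y < \<phi> (from_nat_into ?P n) x"
      by metis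
  qed
qed

section \<open>Utilities built from isotone functions\<close>

text \<open>Weights \<open>(1/2) ^ Suc n\<close> have sum 1, so the weighted series stays in the
  unit interval and converges uniformly. All its terms are isotone, and for a strict pair at least
  one of them increases strictly.\<close>

lemma continuous_utility_if_separating:
  fixes f :: "nat \<Rightarrow> 'a \<Rightarrow> real"
  assumes f: "\<And>n. continuous_map X (top_of_set {0..1}) (f n)" "\<And>n. isotone_on (topspace X) R (f n)"
    and sep: "\<And>x y. \<lbrakk>x \<in> topspace X; y \<in> topspace X; (x, y) \<notin> R\<rbrakk> \<Longrightarrow> \<exists>n. f n y < f n x"
  obtains g where "continuous_map X (top_of_set {0..1}) g" "utility_on (topspace X) R g"
proof -
  have f01: "0 \<le> f n x" "f n x \<le> 1" if "x \<in> topspace X" for n x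
    using f(1)[of n] that by (auto simp: continuous_map_in_subtopology)
  have weights: "(\<lambda>n. (1/2) ^ Suc n) sums (1::real)"
    using power_half_series .
  define g where "g x = (\<Sum>n. f n x * (1/2) ^ Suc n)" for x
  have bound: "norm (f n x * (1/2) ^ Suc n) \<le> (1/2) ^ Suc n" if "x \<in> topspace X" for n x
    using f01[OF that, of n] by (auto simp: abs_mult intro!: mult_left_le_one_le)
  have summable: "summable (\<lambda>n. f n x * (1/2) ^ Suc n)" if "x \<in> topspace X" for x
    using bound[OF that] sums_summable[OF weights] by (rule summable_comparison_test'[rotated])
  show thesis
  proof
    have unif: "uniform_limit (topspace X) (\<lambda>n x. \<Sum>i<n. f i x * (1/2) ^ Suc i) g sequentially"
      unfolding g_def using bound sums_summable[OF weights] by (rule Weierstrass_m_test)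
    \<comment> \<open>\<open>Met_TC\<close> views the reals as an explicit metric space, the setting
      of the uniform limit theorem for maps from an abstract topology.\<close>
    have "continuous_map X Met_TC.mtopology g"
    proof (rule Met_TC.continuous_map_uniform_limit)
      show "\<forall>\<^sub>F n in sequentially. continuous_map X Met_TC.mtopology (\<lambda>x. \<Sum>i<n. f i x * (1/2) ^ Suc i)"
        using f(1) by (intro always_eventually allI)
          (auto simp: continuous_map_in_subtopology intro!: continuous_intros)
      show "\<forall>\<^sub>F n in sequentially. \<forall>x\<in>topspace X. g x \<in> UNIV \<and> dist (\<Sum>i<n. f i x * (1/2) ^ Suc i) (g x) < \<epsilon>"
        if "0 < \<epsilon>" for \<epsilon>
        using unif that by (simp add: uniform_limit_iff)
    qed simp
    moreover have "0 \<le> g x" "g x \<le> 1" if "x \<in> topspace X" for x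
    proof -
      show "0 \<le> g x"
        unfolding g_def using f01[OF that] summable[OF that] by (intro suminf_nonneg) auto
      have "g x \<le> (\<Sum>n. (1/2) ^ Suc n)"
        unfolding g_def using summable[OF that] sums_summable[OF weights] f01[OF that]
        by (intro suminf_le) (auto intro: mult_left_le_one_le)
      then show "g x \<le> 1"
        using sums_unique[OF weights] by simp
    qed
    ultimately show "continuous_map X (top_of_set {0..1}) g"
      by (auto simp: continuous_map_in_subtopology)
    have le: "f n x * (1/2) ^ Suc n \<le> f n y * (1/2) ^ Suc n"
      if "x \<in> topspace X" "y \<in> topspace X" "(x, y) \<in> R" for n x y
      using f(2)[of n] that by (auto simp: isotone_on_def)
    show "utility_on (topspace X) R g"
      unfolding utility_on_def isotone_on_def
    proof (intro conjI ballI impI)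
      fix x y assume xy: "x \<in> topspace X" "y \<in> topspace X"
      show "g x \<le> g y" if "(x, y) \<in> R"
        unfolding g_def using le xy that summable by (intro suminf_le) auto
      show "g x < g y" if R: "(x, y) \<in> R \<and> (y, x) \<notin> R"
      proof -
        \<comment> \<open>Separation is applied to the reversed pair \<open>(y, x)\<close>.\<close>
        obtain n where "f n x < f n y"
          using sep xy R by blast
        then have "0 < (\<Sum>n. f n y * (1/2) ^ Suc n - f n x * (1/2) ^ Suc n)"
          using le[OF xy] R summable xy
          by (intro suminf_pos2[where i=n]) (auto intro!: summable_diff)
        also have "\<dots> = g y - g x"
          unfolding g_def using summable xy by (intro suminf_diff[symmetric])
        finally show ?thesis
          by simp
      qed
    qed
  qed
qed

text \<open>The positive weight on \<open>g\<close> supplies the strict inequality, while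
  \<open>f\<close> contributes a weak one.\<close>

lemma convex_combination_utility:
  assumes f: "continuous_map X (top_of_set {0..1}) f" "isotone_on (topspace X) R f"
    and g: "continuous_map X (top_of_set {0..1}) g" "utility_on (topspace X) R g"
    and t: "0 < t" "t \<le> (1::real)"
  shows "continuous_map X (top_of_set {0..1}) (\<lambda>x. (1 - t) * f x + t * g x) \<and>
    utility_on (topspace X) R (\<lambda>x. (1 - t) * f x + t * g x)"
proof
  have "0 \<le> (1 - t) * f x + t * g x \<and> (1 - t) * f x + t * g x \<le> 1" if "x \<in> topspace X" for x
  proof -
    have "0 \<le> f x" "f x \<le> 1" "0 \<le> g x" "g x \<le> 1"
      using f(1) g(1) that by (auto simp: continuous_map_in_subtopology)
    then show ?thesis
      using t convex_bound_le[of "f x" 1 "g x" "1 - t" t] by simp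
  qed
  then show "continuous_map X (top_of_set {0..1}) (\<lambda>x. (1 - t) * f x + t * g x)"
    using f(1) g(1) by (auto simp: continuous_map_in_subtopology intro!: continuous_intros)
  show "utility_on (topspace X) R (\<lambda>x. (1 - t) * f x + t * g x)"
    using f(2) g(2) t unfolding utility_on_def isotone_on_def
    by (auto intro!: add_mono add_le_less_mono mult_left_mono)
qed

theorem corollary1p4:
  fixes X :: "'a topology" and R :: "'a rel"
  assumes "second_countable X" and "k_omega_space X" and "closed_preorder X R"
  shows "\<exists>u :: nat \<Rightarrow> 'a \<Rightarrow> real.
           (\<forall>k. continuous_map X (top_of_set {0..1}) (u k) \<and> utility_on (topspace X) R (u k)) \<and>
           (\<forall>x\<in>topspace X. \<forall>y\<in>topspace X. (x, y) \<in> R \<longleftrightarrow> (\<forall>k. u k x \<le> u k y))"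
proof -
  have N: "normally_preordered X R"
    using k_omega_imp_normally_preordered assms by blast
  have "\<exists>f::'a \<Rightarrow> real. continuous_map X (top_of_set {0..1}) f \<and> isotone_on (topspace X) R f \<and> f y < f x"
    if "x \<in> topspace X" "y \<in> topspace X" "(x, y) \<notin> R" for x y
    using closed_preorder_separating_isotone[OF N assms(3) that] by blast
  then obtain f :: "nat \<Rightarrow> 'a \<Rightarrow> real" where f: "\<And>n. continuous_map X (top_of_set {0..1}) (f n)"
    "\<And>n. isotone_on (topspace X) R (f n)"
    and sep: "\<And>x y. \<lbrakk>x \<in> topspace X; y \<in> topspace X; (x, y) \<notin> R\<rbrakk> \<Longrightarrow> \<exists>n. f n y < f n x"
    using countable_separating_isotones[OF assms(1), of R] by blast
  obtain g where g: "continuous_map X (top_of_set {0..1}) g" "utility_on (topspace X) R g"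
    using continuous_utility_if_separating[OF f sep] by blast
  \<comment> \<open>The parameter \<open>1 / real (Suc m)\<close> lies in the half-open interval
    from 0 (excluded) to 1 and tends to 0, so \<open>v n m\<close> is a utility for every
    \<open>m\<close> and converges pointwise to \<open>f n\<close>.\<close>
  define v where "v n m x = (1 - 1 / real (Suc m)) * f n x + 1 / real (Suc m) * g x" for n m x
  define u where "u k = v (fst (prod_decode k)) (snd (prod_decode k))" for k
  have v: "continuous_map X (top_of_set {0..1}) (v n m) \<and> utility_on (topspace X) R (v n m)" for n m
    using convex_combination_utility[OF f g, of "1 / real (Suc m)" n] unfolding v_def by simp
  have "(x, y) \<in> R" if xy: "x \<in> topspace X" "y \<in> topspace X" and le: "\<And>k. u k x \<le> u k y" for x y
  proof (rule ccontr)
    assume "(x, y) \<notin> R"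
    then obtain n where n: "f n y < f n x"
      using sep xy by blast
    have lim: "(\<lambda>m. v n m z) \<longlonglongrightarrow> f n z" for z
    proof -
      have "(\<lambda>m. (1 - 1 / real (Suc m)) * f n z + 1 / real (Suc m) * g z) \<longlonglongrightarrow> (1 - 0) * f n z + 0 * g z"
        by (intro tendsto_intros LIMSEQ_Suc[OF lim_1_over_n])
      then show ?thesis
        by (simp add: v_def)
    qed
    \<comment> \<open>Weak inequalities survive the limit in \<open>m\<close>, which contradicts
      \<open>f n y < f n x\<close>.\<close>
    have "v n m x \<le> v n m y" for m
      using le[of "prod_encode (n, m)"] by (simp add: u_def)
    then have "f n x \<le> f n y"
      using lim by (intro LIMSEQ_le[OF lim lim]) auto
    with n show False
      by simp
  qed
  moreover have "u k x \<le> u k y" if "x \<in> topspace X" "y \<in> topspace X" "(x, y) \<in> R" for k x y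
    using v that unfolding u_def utility_on_def isotone_on_def by blast
  ultimately show ?thesis
    using v unfolding u_def by (intro exI[of _ u]) (auto simp: u_def)
qed

end
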